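(* If the $p$-proximal contraction constant $k$ satisfies $0<k<\frac{1}{3}$, then the following best proximity point theorem of Altun et al. follows from the Banach contraction principle: Let $A,B$ be nonempty and closed subsets of a complete metric space $(M,d)$ such that $A_0$ is nonempty and $B$ is approximatively compact with respect to $A$. Let $T:A\rightarrow B$ be a $p$-proximal contraction (with $p$-proximal contraction constant $k$) such that $T(A_0)\subseteq B_0$. Then $T$ has a unique best proximity point.
   Context: Let $(M,d)$ be a metric space and let $A,B$ be nonempty subsets of $M$. Notation: $d(A,B)=\inf\{d(x,y): x\in A,\ y\in B\}$; for $x\in A$, $d(x,B)=\inf\{d(x,y): y\in B\}$; $A_0=\{x\in A: d(x,y)=d(A,B)\text{ for some } y\in B\}$; $B_0=\{y\in B: d(x,y)=d(A,B)\text{ for some } x\in A\}$. $p$-proximal contraction: a mapping $f:A\rightarrow B$ is a $p$-proximal contraction if there exists $k\in(0,1)$ such that for all $u_1,u_2,x_1,x_2\in A$, whenever $d(u_1,f(x_1))=d(A,B)$ and $d(u_2,f(x_2))=d(A,B)$, one has $$d(u_1,u_2)\leq k\Big(d(x_1,x_2)+|d(u_1,x_1)-d(u_2,x_2)|\Big).$$ The constant $k$ is called the $p$-proximal contraction constant. Approximative compactness: $B$ is approximatively compact with respect to $A$ if every sequence $\{y_n\}$ of $B$ satisfying $d(x,y_n)\rightarrow d(x,B)$ as $n\rightarrow\infty$ for some $x\in A$ has a convergent subsequence. Best proximity point: a best proximity point of $T:A\rightarrow B$ is a point $x\in A$ with $d(x,T(x))=d(A,B)$. Banach contraction principle: if $(X,\rho)$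 is a nonempty complete metric space and $S:X\rightarrow X$ satisfies $\rho(S(x),S(y))\leq c\,\rho(x,y)$ for all $x,y\in X$ with some constant $c\in[0,1)$, then $S$ has a unique fixed point, and for every $x_0\in X$ the iterates $S^n(x_0)$ converge to it. *)

theory Defs
  imports "HOL-Analysis.Analysis"
begin

text \<open>
  A metric space is a carrier set \<open>M\<close> with a distance function \<open>d\<close>, as in the library locale
  \<^locale>\<open>Metric_space\<close>; closedness, convergence and completeness are the library's
  \<^const>\<open>closedin\<close>, \<^const>\<open>limitin\<close> and \<^const>\<open>Metric_space.mcomplete\<close>.
  The infima below are real infima, which are meaningful only for nonempty \<open>A\<close> and \<open>B\<close>.
\<close>

definition set_distance :: "('a \<Rightarrow> 'a \<Rightarrow> real) \<Rightarrow> 'a set \<Rightarrow> 'a set \<Rightarrow> real" where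
  "set_distance d A B = Inf {d x y | x y. x \<in> A \<and> y \<in> B}"

definition point_distance :: "('a \<Rightarrow> 'a \<Rightarrow> real) \<Rightarrow> 'a \<Rightarrow> 'a set \<Rightarrow> real" where
  "point_distance d x B = Inf {d x y | y. y \<in> B}"

definition proximal_dom :: "('a \<Rightarrow> 'a \<Rightarrow> real) \<Rightarrow> 'a set \<Rightarrow> 'a set \<Rightarrow> 'a set" where
  "proximal_dom d A B = {x \<in> A. \<exists>y\<in>B. d x y = set_distance d A B}"

definition proximal_cod :: "('a \<Rightarrow> 'a \<Rightarrow> real) \<Rightarrow> 'a set \<Rightarrow> 'a set \<Rightarrow> 'a set" where
  "proximal_cod d A B = {y \<in> B. \<exists>x\<in>A. d x y = set_distance d A B}"

text \<open>\<open>f\<close> is a \<open>p\<close>-proximal contraction from \<open>A\<close> to \<open>B\<close> with contraction constant \<open>k\<close>.\<close>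

definition p_proximal_contraction ::
    "('a \<Rightarrow> 'a \<Rightarrow> real) \<Rightarrow> 'a set \<Rightarrow> 'a set \<Rightarrow> ('a \<Rightarrow> 'a) \<Rightarrow> real \<Rightarrow> bool" where
  "p_proximal_contraction d A B f k \<longleftrightarrow>
     f \<in> A \<rightarrow> B \<and> 0 < k \<and> k < 1 \<and>
     (\<forall>u1\<in>A. \<forall>u2\<in>A. \<forall>x1\<in>A. \<forall>x2\<in>A.
        d u1 (f x1) = set_distance d A B \<and> d u2 (f x2) = set_distance d A B \<longrightarrow>
        d u1 u2 \<le> k * (d x1 x2 + \<bar>d u1 x1 - d u2 x2\<bar>))"

definition approximatively_compact ::
    "'a set \<Rightarrow> ('a \<Rightarrow> 'a \<Rightarrow> real) \<Rightarrow> 'a set \<Rightarrow> 'a set \<Rightarrow> bool" where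
  "approximatively_compact M d B A \<longleftrightarrow>
     (\<forall>y :: nat \<Rightarrow> 'a. range y \<subseteq> B \<and>
        (\<exists>x\<in>A. (\<lambda>n. d x (y n)) \<longlonglongrightarrow> point_distance d x B) \<longrightarrow>
        (\<exists>r l. strict_mono r \<and> limitin (Metric_space.mtopology M d) (y \<circ> r) l sequentially))"

definition best_proximity_point ::
    "('a \<Rightarrow> 'a \<Rightarrow> real) \<Rightarrow> 'a set \<Rightarrow> 'a set \<Rightarrow> ('a \<Rightarrow> 'a) \<Rightarrow> 'a \<Rightarrow> bool" where
  "best_proximity_point d A B T x \<longleftrightarrow> x \<in> A \<and> d x (T x) = set_distance d A B"

text \<open>
  The Banach contraction principle as a proposition about all nonempty complete metric spaces
  \<open>(X, \<rho>)\<close> with \<open>X\<close> a set of elements of type \<^typ>\<open>'a\<close>; HOL cannot quantify over types inside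
  a formula.
\<close>

definition Banach_contraction_principle :: "'a itself \<Rightarrow> bool" where
  "Banach_contraction_principle _ \<longleftrightarrow>
     (\<forall>(X :: 'a set) \<rho> S c.
        Metric_space X \<rho> \<and> Metric_space.mcomplete X \<rho> \<and> X \<noteq> {} \<and> S \<in> X \<rightarrow> X \<and>
        0 \<le> c \<and> c < 1 \<and> (\<forall>x\<in>X. \<forall>y\<in>X. \<rho> (S x) (S y) \<le> c * \<rho> x y) \<longrightarrow>
        (\<exists>p. p \<in> X \<and> S p = p \<and> (\<forall>q\<in>X. S q = q \<longrightarrow> q = p) \<and>
             (\<forall>x0\<in>X. limitin (Metric_space.mtopology X \<rho>) (\<lambda>n. (S ^^ n) x0) p sequentially)))"

text \<open>The principle holds, so a theorem that assumes it is not restricted by it.\<close>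

lemma Banach_contraction_principle_holds: "Banach_contraction_principle TYPE('a)"
  unfolding Banach_contraction_principle_def
proof (intro allI impI, elim conjE)
  fix X :: "'a set" and \<rho> S and c :: real
  assume ms: "Metric_space X \<rho>" and compl: "Metric_space.mcomplete X \<rho>" and ne: "X \<noteq> {}"
    and S: "S \<in> X \<rightarrow> X" and c: "0 \<le> c" "c < 1"
    and con: "\<forall>x\<in>X. \<forall>y\<in>X. \<rho> (S x) (S y) \<le> c * \<rho> x y"
  interpret Metric_space X \<rho> by (rule ms)
  obtain p where p: "p \<in> X" "S p = p"
    using Banach_fixedpoint_thm[OF compl ne S c(2)] con by blast
  have uniq: "q = p" if "q \<in> X" "S q = q" for q
    using contraction_imp_unique_fixpoint[OF that(2) p(2) S c(2)] con that p by blast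
  have lim: "limitin mtopology (\<lambda>n. (S ^^ n) x) p sequentially" if x: "x \<in> X" for x
  proof -
    have mem: "(S ^^ n) x \<in> X" for n
      by (induction n) (use x S in auto)
    have bound: "\<rho> ((S ^^ n) x) p \<le> c ^ n * \<rho> x p" for n
    proof (induction n)
      case (Suc n)
      have "\<rho> ((S ^^ Suc n) x) p \<le> c * \<rho> ((S ^^ n) x) p"
        using con mem[of n] p by force
      also have "\<dots> \<le> c * (c ^ n * \<rho> x p)"
        using Suc c by (intro mult_left_mono)
      finally show ?case by simp
    qed simp
    have "(\<lambda>n. c ^ n * \<rho> x p) \<longlonglongrightarrow> 0"
      using c by (intro tendsto_mult_left_zero LIMSEQ_realpow_zero)
    then have "(\<lambda>n. \<rho> ((S ^^ n) x) p) \<longlonglongrightarrow> 0"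
      by (rule tendsto_sandwich[OF _ _ tendsto_const, rotated 2]) (simp_all add: bound)
    then show ?thesis
      by (simp add: limitin_metric_dist_null p mem)
  qed
  show "\<exists>p. p \<in> X \<and> S p = p \<and> (\<forall>q\<in>X. S q = q \<longrightarrow> q = p) \<and>
          (\<forall>x0\<in>X. limitin mtopology (\<lambda>n. (S ^^ n) x0) p sequentially)"
    using p uniq lim by blast
qed

end

theory Submission
  imports Defs
begin

text \<open>
  On \<open>A\<^sub>0\<close>, sending \<open>x\<close> to the point \<open>u \<in> A\<close> with \<open>d(u, T x) = d(A, B)\<close> is a well-defined self-map \<open>S\<close>
  whose fixed points are the best proximity points of \<open>T\<close>. Since
  \<open>\<bar>d(S x, x) - d(S y, y)\<bar> \<le> d(S x, S y) + d(x, y)\<close>, the \<open>p\<close>-proximal inequality makes \<open>S\<close> a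
  contraction with constant \<open>2k/(1 - k)\<close>, which is below \<open>1\<close> exactly when \<open>k < 1/3\<close>. Approximative
  compactness makes \<open>A\<^sub>0\<close> closed, hence complete.
\<close>

lemma set_distance_le_point_distance:
  assumes "Metric_space M d" "x \<in> A" "B \<noteq> {}"
  shows "set_distance d A B \<le> point_distance d x B"
proof -
  have "bdd_below {d x y | x y. x \<in> A \<and> y \<in> B}"
    using Metric_space.nonneg[OF assms(1)] by (intro bdd_belowI[of _ 0]) auto
  then show ?thesis
    unfolding set_distance_def point_distance_def using assms by (intro cInf_superset_mono) auto
qed

lemma point_distance_le:
  assumes "Metric_space M d" "y \<in> B"
  shows "point_distance d x B \<le> d x y"
proof -
  have "bdd_below {d x y | y. y \<in> B}"
    using Metric_space.nonneg[OF assms(1)] by (intro bdd_belowI[of _ 0]) auto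
  then show ?thesis
    unfolding point_distance_def using assms by (intro cInf_lower) auto
qed

text \<open>If points \<sigma>(n) of \<open>proximal_dom d A B\<close> tend to \<open>x\<close>,
  their partners \<open>y n\<close> in \<open>B\<close> form a minimizing sequence for the distance
  from \<open>x\<close> to \<open>B\<close>. Approximative compactness yields a subsequential limit
  \<open>l\<close>, which is a partner of \<open>x\<close>.\<close>

lemma closedin_proximal_dom:
  assumes metric: "Metric_space M d"
    and closed_A: "closedin (Metric_space.mtopology M d) A"
    and closed_B: "closedin (Metric_space.mtopology M d) B"
    and approx_compact: "approximatively_compact M d B A"
  shows "closedin (Metric_space.mtopology M d) (proximal_dom d A B)"
proof -
  interpret Metric_space M d by (rule metric)
  let ?D = "set_distance d A B"
  have AM: "A \<subseteq> M" and BM: "B \<subseteq> M"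
    using closed_A closed_B closedin_subset by fastforce+
  show ?thesis
    unfolding metric_closedin_iff_sequentially_closed
  proof (intro conjI allI impI; (elim conjE)?)
    show "proximal_dom d A B \<subseteq> M"
      using AM by (auto simp: proximal_dom_def)
    fix \<sigma> x assume \<sigma>: "range \<sigma> \<subseteq> proximal_dom d A B" and lim: "limitin mtopology \<sigma> x sequentially"
    have \<sigma>A: "\<sigma> n \<in> A" for n
      using \<sigma> by (auto simp: proximal_dom_def)
    have xA: "x \<in> A"
      using closed_A lim \<sigma>A unfolding metric_closedin_iff_sequentially_closed by blast
    have "\<forall>n. \<exists>y\<in>B. d (\<sigma> n) y = ?D"
      using \<sigma> by (auto simp: proximal_dom_def)
    then obtain y where yB: "\<And>n. y n \<in> B" and yD: "\<And>n. d (\<sigma> n) (y n) = ?D"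
      by metis
    have \<sigma>0: "(\<lambda>n. d (\<sigma> n) x) \<longlonglongrightarrow> 0"
      using lim by (simp add: limitin_metric_dist_null)
    have ge: "?D \<le> point_distance d x B"
      using set_distance_le_point_distance[OF metric xA] yB by blast
    have upper: "d x (y n) \<le> d (\<sigma> n) x + ?D" for n
      using triangle[of x "\<sigma> n" "y n"] xA \<sigma>A[of n] yB[of n] AM BM yD[of n] commute[of x "\<sigma> n"]
      by auto
    have up0: "(\<lambda>n. d (\<sigma> n) x + ?D) \<longlonglongrightarrow> ?D"
      using tendsto_add[OF \<sigma>0 tendsto_const[of ?D]] by simp
    \<comment> \<open>The right-hand side tends to \<open>?D\<close>, so \<open>x\<close> is as
      close to \<open>B\<close> as \<open>A\<close> ever gets. This makes \<open>y\<close> a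
      sequence of the kind that approximative compactness speaks of.\<close>
    have "point_distance d x B \<le> d (\<sigma> n) x + ?D" for n
      using point_distance_le[OF metric yB] upper order_trans by blast
    then have eq: "point_distance d x B = ?D"
      using ge LIMSEQ_le_const[OF up0] by (meson antisym)
    have lower: "?D \<le> d x (y n)" for n
      using point_distance_le[OF metric yB] ge order_trans by blast
    have "(\<lambda>n. d x (y n)) \<longlonglongrightarrow> point_distance d x B"
      unfolding eq by (rule tendsto_sandwich[OF _ _ tendsto_const up0]) (simp_all add: lower upper)
    then obtain r l where r: "strict_mono r" and l: "limitin mtopology (y \<circ> r) l sequentially"
      using approx_compact yB xA unfolding approximatively_compact_def by blast
    have lB: "l \<in> B"
      using closed_B l yB unfolding metric_closedin_iff_sequentially_closed by force
    have l0: "(\<lambda>n. d (y (r n)) l) \<longlonglongrightarrow> 0"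
      using l by (simp add: limitin_metric_dist_null o_def)
    \<comment> \<open>Passing through \<open>y (r n)\<close> bounds the fixed number
      \<open>d x l\<close> by a sequence tending to \<open>?D\<close>.\<close>
    have "d x l \<le> d (\<sigma> (r n)) x + ?D + d (y (r n)) l" for n
      using triangle[of x "y (r n)" l] upper[of "r n"] xA lB yB AM BM by fastforce
    moreover have "(\<lambda>n. d (\<sigma> (r n)) x + ?D + d (y (r n)) l) \<longlonglongrightarrow> ?D + 0"
      by (intro tendsto_add l0) (use LIMSEQ_subseq_LIMSEQ[OF up0 r] in \<open>simp add: o_def\<close>)
    ultimately have "d x l \<le> ?D"
      using LIMSEQ_le_const by fastforce
    then have "d x l = ?D"
      using point_distance_le[OF metric lB, of x] ge by linarith
    then show "x \<in> proximal_dom d A B"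
      using xA lB by (auto simp: proximal_dom_def)
  qed
qed

text \<open>Keeping \<open>u\<close> and \<open>v\<close> arbitrary, rather than values of one
  chosen map, lets the bound give uniqueness of the proximal point too: for \<open>x = y\<close> the
  right-hand side vanishes.\<close>

lemma p_proximal_contraction_dist_le:
  assumes metric: "Metric_space M d" and AM: "A \<subseteq> M"
    and contraction: "p_proximal_contraction d A B T k"
    and mem: "u \<in> A" "v \<in> A" "x \<in> A" "y \<in> A"
    and u: "d u (T x) = set_distance d A B" and v: "d v (T y) = set_distance d A B"
  shows "d u v \<le> 2 * k / (1 - k) * d x y"
proof -
  interpret Metric_space M d by (rule metric)
  have k: "0 < k" "k < 1" and "d u v \<le> k * (d x y + \<bar>d u x - d v y\<bar>)"
    using contraction mem u v unfolding p_proximal_contraction_def by blast+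
  \<comment> \<open>Go from \<open>u\<close> to \<open>x\<close> via \<open>v\<close> and
    \<open>y\<close>, and from \<open>v\<close> to \<open>y\<close> via \<open>u\<close> and
    \<open>x\<close>.\<close>
  moreover have "\<bar>d u x - d v y\<bar> \<le> d u v + d x y"
    using triangle[of u v x] triangle[of v y x] triangle[of v u y] triangle[of u x y]
      mem AM commute[of u v] commute[of x y] by fastforce
  ultimately have "d u v \<le> k * (d x y + (d u v + d x y))"
    by (smt (verit) mult_left_mono)
  \<comment> \<open>The term \<open>k * d u v\<close> moves to the left, and dividing by
    \<open>1 - k > 0\<close> gives the constant.\<close>
  with k show ?thesis
    by (simp add: field_simps)
qed

theorem theorem2p6:
  fixes M :: "'a set" and d :: "'a \<Rightarrow> 'a \<Rightarrow> real" and A B :: "'a set"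
    and T :: "'a \<Rightarrow> 'a" and k :: real
  assumes k_bounds: "0 < k" "k < 1 / 3"
    and banach: "Banach_contraction_principle TYPE('a)"
    and metric: "Metric_space M d"
    and complete: "Metric_space.mcomplete M d"
    and nonempty: "A \<noteq> {}" "B \<noteq> {}"
    and closed_A: "closedin (Metric_space.mtopology M d) A"
    and closed_B: "closedin (Metric_space.mtopology M d) B"
    and A0_nonempty: "proximal_dom d A B \<noteq> {}"
    and approx_compact: "approximatively_compact M d B A"
    and contraction: "p_proximal_contraction d A B T k"
    and T_A0: "T ` proximal_dom d A B \<subseteq> proximal_cod d A B"
  shows "\<exists>!x. best_proximity_point d A B T x"
proof -
  interpret Metric_space M d by (rule metric)
  let ?D = "set_distance d A B" and ?A0 = "proximal_dom d A B" and ?c = "2 * k / (1 - k)"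
  have AM: "A \<subseteq> M"
    using closed_A closedin_subset by fastforce
  have A0A: "?A0 \<subseteq> A"
    by (auto simp: proximal_dom_def)
  have TB: "T x \<in> B" if "x \<in> A" for x
    using contraction that by (auto simp: p_proximal_contraction_def)
  \<comment> \<open>The Banach principle is applied to \<open>?A0\<close> with the restricted
    metric, complete as a closed subset of \<open>M\<close>.\<close>
  interpret sub: Submetric M d ?A0
    by unfold_locales (use A0A AM in auto)
  have complete_A0: "Metric_space.mcomplete ?A0 d"
    using sub.closedin_eq_mcomplete[OF complete]
      closedin_proximal_dom[OF metric closed_A closed_B approx_compact] by blast
  have "\<forall>x\<in>?A0. \<exists>u\<in>A. d u (T x) = ?D"
    using T_A0 by (fastforce simp: proximal_cod_def)
  then obtain S where SA: "\<And>x. x \<in> ?A0 \<Longrightarrow> S x \<in> A"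
    and SD: "\<And>x. x \<in> ?A0 \<Longrightarrow> d (S x) (T x) = ?D"
    by metis
  \<comment> \<open>The point \<open>T x\<close> of \<open>B\<close> itself witnesses that
    \<open>S x\<close> lies in \<open>?A0\<close>.\<close>
  have SA0: "S \<in> ?A0 \<rightarrow> ?A0"
    using SA SD TB A0A unfolding proximal_dom_def by blast
  have c: "0 \<le> ?c" "?c < 1"
    using k_bounds by (simp_all add: field_simps)
  have S_contraction: "\<forall>x\<in>?A0. \<forall>y\<in>?A0. d (S x) (S y) \<le> ?c * d x y"
    using p_proximal_contraction_dist_le[OF metric AM contraction] SA SD A0A by blast
  obtain p where p: "p \<in> ?A0" "S p = p" and uniq: "\<And>q. q \<in> ?A0 \<Longrightarrow> S q = q \<Longrightarrow> q = p"
    using banach[unfolded Banach_contraction_principle_def, rule_format, of ?A0 d S ?c]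
      sub.sub.Metric_space_axioms complete_A0 A0_nonempty SA0 c S_contraction by blast
  show ?thesis
  proof (rule ex1I)
    show "best_proximity_point d A B T p"
      using SA[OF p(1)] SD[OF p(1)] p(2) by (simp add: best_proximity_point_def)
    fix q assume "best_proximity_point d A B T q"
    then have q: "q \<in> A" "d q (T q) = ?D"
      by (auto simp: best_proximity_point_def)
    then have q0: "q \<in> ?A0"
      using TB by (auto simp: proximal_dom_def)
    \<comment> \<open>\<open>S\<close> was obtained by choice, so \<open>S q = q\<close> needs an
      argument: \<open>q\<close> and \<open>S q\<close> both have distance \<open>?D\<close> from
      \<open>T q\<close>, and \<open>d q q = 0\<close>.\<close>
    have "d (S q) q \<le> ?c * d q q"
      using p_proximal_contraction_dist_le[OF metric AM contraction] SA SD q q0 by blast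
    moreover have "q \<in> M" "S q \<in> M"
      using q SA[OF q0] AM by auto
    ultimately have "S q = q"
      using nonneg[of "S q" q] by simp
    then show "q = p"
      using uniq q0 by blast
  qed
qed

end
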